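(* Let $E$ be a Banach space, $I=I^r=[-r,0]$ for some $0<r<\infty$, $H\subset\mathrm{Map}(I^r,E)$ a history space which is prolongable and regulated by prolongations, and $F\colon\mathbb{R}\times H\supset\mathrm{dom}(F)\to E$ a map. Let $F^{0,1}$ be the restriction of $F$ to $\mathrm{dom}(F^{0,1})=\mathrm{dom}(F)\cap\bigl(\mathbb{R}\times C^{0,1}_{\mathrm{loc}}(I^r,E)\bigr)$. If $F$ is almost locally Lipschitzian at $(\sigma_0,\psi_0)\in\mathrm{dom}(F^{0,1})$, then $F^{0,1}$ is locally Lipschitzian about $C^1$-prolongations at $(\sigma_0,\psi_0)$.
   Context: Basic notation. $\mathbb{R}_+=[0,\infty)$. $\mathrm{Map}(I,E)$ is the linear space of all maps $I\to E$; $\boldsymbol 0$ is the zero map. For an interval $J$, $J+I=\{t+\theta:t\in J,\theta\in I\}$. If $\gamma\colon J+I\to E$ and $t\in J$, then $I_t\gamma\in\mathrm{Map}(I,E)$ is $I_t\gamma(\theta)=\gamma(t+\theta)$. A history space is a linear subspace $H\subset\mathrm{Map}(I,E)$ with a topology for which the linear operations are continuous. $\mathrm{lip}(f)$ is the least Lipschitz constant of $f$ ($\infty$ if $f$ is not Lipschitz). $C^{0,1}_{\mathrm{loc}}(I,E)$ is the space of locally Lipschitz continuous maps $I\to E$; for compact $I$ it equals the space $C^{0,1}(I,E)$ of Lipschitz maps. (Prolongability of $H$ implies $C(I^r,E)\subset H$, hence $C^{0,1}_{\mathrm{loc}}(I^r,E)\subset H$.) The map $F^{0,1}$ is regarded as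 a map $\mathbb{R}\times C^{0,1}_{\mathrm{loc}}(I,E)\supset\mathrm{dom}(F^{0,1})\to E$. Prolongations. For $(\sigma,\psi)\in\mathbb{R}\times\mathrm{Map}(I,E)$, a prolongation (resp. $C^1$-prolongation) of $(\sigma,\psi)$ is a map $\gamma\colon J+I\to E$, where $J$ is an interval with left end point $\sigma\in J$ ($J=\{\sigma\}$ allowed, counting as $C^1$), with $I_\sigma\gamma=\psi$ and $\gamma|_J$ continuous (resp. of class $C^1$). A prolongation of $\psi$ is one of $(0,\psi)$. For $v\in E$, $\psi^{\wedge v}\colon\mathbb{R}_++I\to E$ is $\psi^{\wedge v}(t)=\psi(t)$ for $t\in I$ and $\psi^{\wedge v}(t)=\psi(0)+tv$ for $t\ge0$. $\|g\|_{C^1[0,T]}=\sup_{[0,T]}\|g\|_E+\sup_{[0,T]}\|g'\|_E$. $\varGamma_{\sigma,\psi}(T,\delta)$ ($T\ge0$, $0\le\delta\le\infty$) is the set of prolongations $\gamma\colon[\sigma,\sigma+T]+I\to E$ of $(\sigma,\psi)$ with $\sup_{s\in[0,T]}\|\gamma(\sigma+s)-\psi(0)\|_E\le\delta$. $\varGamma^1_{\sigma,\psi}(T,\delta,v)$ ($T>0$) is the set of $C^1$-prolongations $\gamma\colon[\sigma,\sigma+T]+I\to E$ of $(\sigma,\psi)$ with $\|\gamma(\sigma+\cdot)-\psi^{\wedge v}(\cdot)\|_{C^1[0,T]}\le\delta$ and $\gamma'(\sigma)=v$ (right derivative); $\varGamma^1_{\sigma,\psi}(0,\delta,v)=\{\psi(\cdot-\sigma)\}$.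 Put $$\varLambda_{\sigma,\psi}(T,\delta)=\bigcup_{\tau\in[0,T]}\{(\sigma+\tau,I_{\sigma+\tau}\gamma):\gamma\in\varGamma_{\sigma,\psi}(\tau,\delta)\},$$ $$\varLambda^1_{\sigma,\psi}(T,\delta,v)=\bigcup_{\tau\in[0,T]}\{(\sigma+\tau,I_{\sigma+\tau}\gamma):\gamma\in\varGamma^1_{\sigma,\psi}(\tau,\delta,v)\}.$$ $H$ is prolongable if for every $\psi\in H$ and every prolongation $\gamma\colon\mathbb{R}_++I\to E$ of $\psi$ one has $I_t\gamma\in H$ for all $t\ge0$ and $t\mapsto I_t\gamma\in H$ is continuous on $\mathbb{R}_+$. $H$ is regulated by prolongations if for every $T>0$ and every neighborhood $N$ of $\boldsymbol 0$ in $H$ there is $\delta>0$ with $\varLambda_{0,\boldsymbol 0}(T,\delta)\subset[0,T]\times N$. Lipschitz conditions. For a map $G$ with domain in $\mathbb{R}\times\mathrm{Map}(I,E)$, $L>0$ and $(t,\phi_1),(t,\phi_2)\in\mathrm{dom}(G)$ with $\mathrm{supp}(\phi_1-\phi_2)$ compact, $L$-(Lip) for $G$ is $\|G(t,\phi_1)-G(t,\phi_2)\|_E\le L\|\phi_1-\phi_2\|_\infty$. $F$ is almost locally Lipschitzian at $(\sigma_0,\psi_0)$ if for every $M>0$ there are a neighborhood $W$ of $(\sigma_0,\psi_0)$ in $\mathbb{R}\times H$ and $L>0$ such that $L$-(Lip) for $F$ holds for all $(t,\phi_1),(t,\phi_2)\in W\cap\mathrm{dom}(F)$ with $\mathrm{lip}(\phi_i)\le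 M$ ($i=1,2$). $F^{0,1}$ is locally Lipschitzian about $C^1$-prolongations at $(\sigma_0,\psi_0)\in\mathrm{dom}(F^{0,1})$ if there are $T,\delta,L>0$ such that $L$-(Lip) for $F^{0,1}$ holds for all $(t,\phi_1),(t,\phi_2)\in\varLambda^1_{\sigma_0,\psi_0}(T,\delta,v)\cap\mathrm{dom}(F^{0,1})$, where $v=F(\sigma_0,\psi_0)$. *)

theory Defs
  imports "HOL-Analysis.Analysis"
begin

text \<open>
  A map from a set \<open>S\<close> of reals to \<open>E\<close> is encoded as a function on all reals that vanishes
  outside \<open>S\<close>, so that the zero map and the linear operations are the pointwise ones.
  Continuity, Lipschitz constants, suprema and supports are always taken relative to \<open>S\<close>;
  the values outside \<open>S\<close> carry no information.  \<open>J + I\<close> is the Minkowski sum of sets.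
\<close>

definition Maps :: "real set \<Rightarrow> (real \<Rightarrow> 'a::real_normed_vector) set" where
  "Maps S = {f. \<forall>x. x \<notin> S \<longrightarrow> f x = 0}"

definition hist_at :: "real set \<Rightarrow> real \<Rightarrow> (real \<Rightarrow> 'a::real_normed_vector) \<Rightarrow> (real \<Rightarrow> 'a)" where
  "hist_at I t \<gamma> = (\<lambda>\<theta>. if \<theta> \<in> I then \<gamma> (t + \<theta>) else 0)"

text \<open>The topology on \<open>H\<close> is the one given by \<open>X\<close>; it need not be Hausdorff.\<close>

definition history_space ::
  "real set \<Rightarrow> (real \<Rightarrow> 'a::real_normed_vector) set \<Rightarrow> (real \<Rightarrow> 'a) topology \<Rightarrow> bool" where
  "history_space I H X \<longleftrightarrow>
     H \<subseteq> Maps I \<and> (\<lambda>_. 0) \<in> H \<and>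
     (\<forall>f\<in>H. \<forall>g\<in>H. (\<lambda>\<theta>. f \<theta> + g \<theta>) \<in> H) \<and>
     (\<forall>c. \<forall>f\<in>H. (\<lambda>\<theta>. c *\<^sub>R f \<theta>) \<in> H) \<and>
     topspace X = H \<and>
     continuous_map (prod_topology X X) X (\<lambda>(f, g). \<lambda>\<theta>. f \<theta> + g \<theta>) \<and>
     continuous_map (prod_topology euclideanreal X) X (\<lambda>(c, f). \<lambda>\<theta>. c *\<^sub>R f \<theta>)"

definition nbhd :: "'b topology \<Rightarrow> 'b \<Rightarrow> 'b set \<Rightarrow> bool" where
  "nbhd X x N \<longleftrightarrow> N \<subseteq> topspace X \<and> (\<exists>U. openin X U \<and> x \<in> U \<and> U \<subseteq> N)"

definition sup_norm :: "real set \<Rightarrow> (real \<Rightarrow> 'a::real_normed_vector) \<Rightarrow> ennreal" where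
  "sup_norm S f = (SUP x\<in>S. ennreal (norm (f x)))"

definition lip :: "real set \<Rightarrow> (real \<Rightarrow> 'a::real_normed_vector) \<Rightarrow> ennreal" where
  "lip S f = Inf {ennreal C |C. C-lipschitz_on S f}"

definition C01_loc :: "real set \<Rightarrow> (real \<Rightarrow> 'a::real_normed_vector) set" where
  "C01_loc I = {f \<in> Maps I. \<forall>x\<in>I. \<exists>\<epsilon>>0. \<exists>C. C-lipschitz_on (I \<inter> ball x \<epsilon>) f}"

text \<open>The support of a map on \<open>I\<close>: the closure is taken in \<open>I\<close>.\<close>

definition supp :: "real set \<Rightarrow> (real \<Rightarrow> 'a::real_normed_vector) \<Rightarrow> real set" where
  "supp I f = I \<inter> closure {x\<in>I. f x \<noteq> 0}"

text \<open>For \<open>J = {\<sigma>}\<close> the filter \<open>at \<sigma> within J\<close> is trivial, so every map is \<open>C\<^sup>1\<close> on \<open>J\<close>.\<close>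

definition C1_on :: "real set \<Rightarrow> (real \<Rightarrow> 'a::real_normed_vector) \<Rightarrow> bool" where
  "C1_on J f \<longleftrightarrow>
     (\<exists>f'. continuous_on J f' \<and> (\<forall>t\<in>J. (f has_vector_derivative f' t) (at t within J)))"

definition C1_norm :: "real \<Rightarrow> (real \<Rightarrow> 'a::real_normed_vector) \<Rightarrow> ennreal" where
  "C1_norm T g =
     sup_norm {0..T} g + sup_norm {0..T} (\<lambda>t. vector_derivative g (at t within {0..T}))"

definition prolongation ::
  "real set \<Rightarrow> real \<Rightarrow> (real \<Rightarrow> 'a::real_normed_vector) \<Rightarrow> real set \<Rightarrow> (real \<Rightarrow> 'a) \<Rightarrow> bool" where
  "prolongation I \<sigma> \<psi> J \<gamma> \<longleftrightarrow>
     is_interval J \<and> \<sigma> \<in> J \<and> (\<forall>t\<in>J. \<sigma> \<le> t) \<and>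
     \<gamma> \<in> Maps (J + I) \<and> hist_at I \<sigma> \<gamma> = \<psi> \<and> continuous_on J \<gamma>"

definition C1_prolongation ::
  "real set \<Rightarrow> real \<Rightarrow> (real \<Rightarrow> 'a::real_normed_vector) \<Rightarrow> real set \<Rightarrow> (real \<Rightarrow> 'a) \<Rightarrow> bool" where
  "C1_prolongation I \<sigma> \<psi> J \<gamma> \<longleftrightarrow> prolongation I \<sigma> \<psi> J \<gamma> \<and> C1_on J \<gamma>"

definition wedge :: "(real \<Rightarrow> 'a::real_normed_vector) \<Rightarrow> 'a \<Rightarrow> (real \<Rightarrow> 'a)" where
  "wedge \<psi> v = (\<lambda>t. if 0 \<le> t then \<psi> 0 + t *\<^sub>R v else \<psi> t)"

definition Gam ::
  "real set \<Rightarrow> real \<Rightarrow> (real \<Rightarrow> 'a::real_normed_vector) \<Rightarrow> real \<Rightarrow> ennreal \<Rightarrow> (real \<Rightarrow> 'a) set" where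
  "Gam I \<sigma> \<psi> T \<delta> =
     {\<gamma>. prolongation I \<sigma> \<psi> {\<sigma>..\<sigma> + T} \<gamma> \<and> sup_norm {0..T} (\<lambda>s. \<gamma> (\<sigma> + s) - \<psi> 0) \<le> \<delta>}"

definition Gam1 ::
  "real set \<Rightarrow> real \<Rightarrow> (real \<Rightarrow> 'a::real_normed_vector) \<Rightarrow> real \<Rightarrow> ennreal \<Rightarrow> 'a \<Rightarrow> (real \<Rightarrow> 'a) set" where
  "Gam1 I \<sigma> \<psi> T \<delta> v =
     (if T = 0 then {\<lambda>t. \<psi> (t - \<sigma>)}
      else {\<gamma>. C1_prolongation I \<sigma> \<psi> {\<sigma>..\<sigma> + T} \<gamma> \<and>
               C1_norm T (\<lambda>s. \<gamma> (\<sigma> + s) - wedge \<psi> v s) \<le> \<delta> \<and>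
               (\<gamma> has_vector_derivative v) (at_right \<sigma>)})"

definition Lam ::
  "real set \<Rightarrow> real \<Rightarrow> (real \<Rightarrow> 'a::real_normed_vector) \<Rightarrow> real \<Rightarrow> ennreal \<Rightarrow> (real \<times> (real \<Rightarrow> 'a)) set" where
  "Lam I \<sigma> \<psi> T \<delta> = (\<Union>\<tau>\<in>{0..T}. {(\<sigma> + \<tau>, hist_at I (\<sigma> + \<tau>) \<gamma>) |\<gamma>. \<gamma> \<in> Gam I \<sigma> \<psi> \<tau> \<delta>})"

definition Lam1 ::
  "real set \<Rightarrow> real \<Rightarrow> (real \<Rightarrow> 'a::real_normed_vector) \<Rightarrow> real \<Rightarrow> ennreal \<Rightarrow> 'a \<Rightarrow>
     (real \<times> (real \<Rightarrow> 'a)) set" where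
  "Lam1 I \<sigma> \<psi> T \<delta> v =
     (\<Union>\<tau>\<in>{0..T}. {(\<sigma> + \<tau>, hist_at I (\<sigma> + \<tau>) \<gamma>) |\<gamma>. \<gamma> \<in> Gam1 I \<sigma> \<psi> \<tau> \<delta> v})"

definition prolongable ::
  "real set \<Rightarrow> (real \<Rightarrow> 'a::real_normed_vector) set \<Rightarrow> (real \<Rightarrow> 'a) topology \<Rightarrow> bool" where
  "prolongable I H X \<longleftrightarrow>
     (\<forall>\<psi>\<in>H. \<forall>\<gamma>. prolongation I 0 \<psi> {0..} \<gamma> \<longrightarrow>
        (\<forall>t\<ge>0. hist_at I t \<gamma> \<in> H) \<and>
        continuous_map (top_of_set {0..}) X (\<lambda>t. hist_at I t \<gamma>))"

definition regulated_by_prolongations ::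
  "real set \<Rightarrow> (real \<Rightarrow> 'a::real_normed_vector) topology \<Rightarrow> bool" where
  "regulated_by_prolongations I X \<longleftrightarrow>
     (\<forall>T>0. \<forall>N. nbhd X (\<lambda>_. 0) N \<longrightarrow>
        (\<exists>\<delta>::real. 0 < \<delta> \<and> Lam I 0 (\<lambda>_. 0) T (ennreal \<delta>) \<subseteq> {0..T} \<times> N))"

definition Lip_cond ::
  "real set \<Rightarrow> (real \<times> (real \<Rightarrow> 'a) \<rightharpoonup> 'a::real_normed_vector) \<Rightarrow> real \<Rightarrow>
     real \<Rightarrow> (real \<Rightarrow> 'a) \<Rightarrow> (real \<Rightarrow> 'a) \<Rightarrow> bool" where
  "Lip_cond I G L t \<phi>1 \<phi>2 \<longleftrightarrow>
     ennreal (norm (the (G (t, \<phi>1)) - the (G (t, \<phi>2))))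
       \<le> ennreal L * sup_norm I (\<lambda>\<theta>. \<phi>1 \<theta> - \<phi>2 \<theta>)"

definition almost_locally_Lipschitzian ::
  "real set \<Rightarrow> (real \<Rightarrow> 'a) topology \<Rightarrow> (real \<times> (real \<Rightarrow> 'a) \<rightharpoonup> 'a::real_normed_vector) \<Rightarrow>
     real \<Rightarrow> (real \<Rightarrow> 'a) \<Rightarrow> bool" where
  "almost_locally_Lipschitzian I X F \<sigma>\<^sub>0 \<psi>\<^sub>0 \<longleftrightarrow>
     (\<forall>M::real. 0 < M \<longrightarrow>
       (\<exists>W L. nbhd (prod_topology euclideanreal X) (\<sigma>\<^sub>0, \<psi>\<^sub>0) W \<and> 0 < L \<and>
         (\<forall>t \<phi>1 \<phi>2. (t, \<phi>1) \<in> W \<inter> dom F \<and> (t, \<phi>2) \<in> W \<inter> dom F \<and>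
            compact (supp I (\<lambda>\<theta>. \<phi>1 \<theta> - \<phi>2 \<theta>)) \<and>
            lip I \<phi>1 \<le> ennreal M \<and> lip I \<phi>2 \<le> ennreal M \<longrightarrow>
            Lip_cond I F L t \<phi>1 \<phi>2)))"

definition restrict_C01 ::
  "real set \<Rightarrow> (real \<times> (real \<Rightarrow> 'a) \<rightharpoonup> 'a::real_normed_vector) \<Rightarrow> (real \<times> (real \<Rightarrow> 'a) \<rightharpoonup> 'a)" where
  "restrict_C01 I F = F |` (UNIV \<times> C01_loc I)"

definition locally_Lipschitzian_about_C1_prolongations ::
  "real set \<Rightarrow> (real \<times> (real \<Rightarrow> 'a) \<rightharpoonup> 'a::real_normed_vector) \<Rightarrow> real \<Rightarrow> (real \<Rightarrow> 'a) \<Rightarrow> bool" where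
  "locally_Lipschitzian_about_C1_prolongations I G \<sigma>\<^sub>0 \<psi>\<^sub>0 \<longleftrightarrow>
     (\<exists>T \<delta> L :: real. 0 < T \<and> 0 < \<delta> \<and> 0 < L \<and>
       (let \<Lambda> = Lam1 I \<sigma>\<^sub>0 \<psi>\<^sub>0 T (ennreal \<delta>) (the (G (\<sigma>\<^sub>0, \<psi>\<^sub>0))) in
         \<forall>t \<phi>1 \<phi>2. (t, \<phi>1) \<in> \<Lambda> \<inter> dom G \<and> (t, \<phi>2) \<in> \<Lambda> \<inter> dom G \<and>
           compact (supp I (\<lambda>\<theta>. \<phi>1 \<theta> - \<phi>2 \<theta>)) \<longrightarrow>
           Lip_cond I G L t \<phi>1 \<phi>2))"

end

theory Submission
  imports Defs
begin

text \<open>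
  A history \<open>\<phi>\<close> occurring in \<open>Lam1\<close> at time \<open>\<sigma> + \<tau>\<close> comes from a prolongation \<open>\<gamma>\<close> that is
  \<open>C\<^sup>1\<close>-close to the affine prolongation \<open>wedge \<psi> v\<close>.  Subtracting the latter from the shifted
  \<open>\<gamma>\<close> leaves a map \<open>\<beta>\<close> that vanishes on \<open>[-r, 0]\<close>, is uniformly at most \<open>\<delta>\<close> and has derivative at
  most \<open>\<delta>\<close>.  So \<open>\<phi>\<close> is the segment of \<open>wedge \<psi> v\<close> plus the segment of a small prolongation of
  \<open>0\<close> (\<open>Lam1_decomposition\<close>), and both facts needed about \<open>\<phi>\<close> follow from this sum.

  First, \<open>\<phi>\<close> is close to \<open>\<psi>\<close> in \<open>H\<close>: prolongability makes the segments of \<open>wedge \<psi> v\<close> converge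
  to \<open>\<psi>\<close> as \<open>\<tau>\<close> tends to \<open>0\<close>, regulation by prolongations makes the segment of \<open>\<beta>\<close> small, and
  addition in \<open>H\<close> is continuous (\<open>Lam1_subset_nbhd\<close>).  Secondly, \<open>\<phi>\<close> has a Lipschitz constant
  that depends only on \<open>\<psi>\<close>, \<open>v\<close> and \<open>\<delta>\<close>: the segment of \<open>wedge \<psi> v\<close> inherits the larger one of
  \<open>\<parallel>v\<parallel>\<close> and a Lipschitz constant of \<open>\<psi>\<close>, and \<open>\<beta>\<close> contributes \<open>\<delta>\<close> (\<open>Lam1_lipschitz\<close>).

  The almost local Lipschitz condition, taken for that Lipschitz constant with \<open>\<delta> = 1\<close>, provides
  a neighbourhood of \<open>(\<sigma>, \<psi>)\<close>; shrinking \<open>T\<close> and \<open>\<delta> \<le> 1\<close> then puts all of \<open>Lam1\<close> inside it.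
\<close>

section \<open>Locally Lipschitz histories and their affine prolongations\<close>

lemma C01_loc_compact_imp_lipschitz:
  assumes "compact I" and "f \<in> C01_loc I"
  obtains C where "C-lipschitz_on I f"
proof -
  \<comment> \<open>A parameter set with one point turns the parametrised notion into the plain one.\<close>
  have "local_lipschitz {0::real} I (\<lambda>_. f)"
  proof (rule local_lipschitzI)
    fix t x assume "x \<in> I"
    then obtain e C where e: "e > 0" and C: "C-lipschitz_on (I \<inter> ball x e) f"
      using assms(2) unfolding C01_loc_def by blast
    have "C-lipschitz_on (cball x (e/2) \<inter> I) f"
      by (rule lipschitz_on_subset[OF C]) (use e in auto)
    then show "\<exists>u>0. \<exists>L. \<forall>s\<in>cball t u \<inter> {0}. L-lipschitz_on (cball x u \<inter> I) f"
      using e by (intro exI[of _ "e/2"]) auto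
  qed
  from local_lipschitz_compact_implies_lipschitz[OF this assms(1)] that
  show thesis by auto
qed

lemma wedge_lipschitz:
  assumes C: "C-lipschitz_on {-r..0} \<psi>"
  shows "(max C (norm v))-lipschitz_on {-r..b} (wedge \<psi> v)"
proof -
  have "(norm v)-lipschitz_on {0..b} (\<lambda>t. \<psi> 0 + t *\<^sub>R v)"
    by (rule lipschitz_onI) (auto simp: dist_norm simp flip: scaleR_diff_left)
  from lipschitz_on_concat_max[OF C this]
  have "(max C (norm v))-lipschitz_on {-r..b} (\<lambda>t. if t \<le> 0 then \<psi> t else \<psi> 0 + t *\<^sub>R v)"
    by simp
  then show ?thesis
    by (rule lipschitz_on_transform) (auto simp: wedge_def)
qed

lemma hist_at_wedge_0:
  assumes "\<psi> \<in> Maps {-r..0}"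
  shows "hist_at {-r..0} 0 (wedge \<psi> v) = \<psi>"
  using assms by (auto simp: hist_at_def wedge_def Maps_def fun_eq_iff)

lemma wedge_prolongation:
  assumes "0 \<le> r" and "\<psi> \<in> Maps {-r..0}"
  shows "prolongation {-r..0} 0 \<psi> {0..} (wedge \<psi> v)"
  unfolding prolongation_def
proof (intro conjI)
  have "x \<in> {0..} + {-r..0}" if "-r \<le> x" for x
    using set_plus_intro[of "x + r" "{0..}" "-r" "{-r..0}"] that assms(1) by auto
  then show "wedge \<psi> v \<in> Maps ({0..} + {-r..0})"
    using assms unfolding Maps_def wedge_def by force
  have "continuous_on {0..} (\<lambda>t. \<psi> 0 + t *\<^sub>R v)"
    by (intro continuous_intros)
  then show "continuous_on {0..} (wedge \<psi> v)"
    by (rule continuous_on_eq) (simp add: wedge_def)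
qed (use hist_at_wedge_0[OF assms(2)] in \<open>auto simp: is_interval_ci\<close>)

section \<open>Histories along prolongations close to the affine one\<close>

lemma C1_norm_bounded_imp_lipschitz:
  assumes g: "C1_on {0..T} g" and "C1_norm T g \<le> ennreal \<delta>" and "0 \<le> \<delta>"
  shows "\<delta>-lipschitz_on {0..T} g"
proof (rule bounded_derivative_imp_lipschitz)
  let ?g' = "\<lambda>t. vector_derivative g (at t within {0..T})"
  fix t assume t: "t \<in> {0..T}"
  have "(g has_vector_derivative ?g' t) (at t within {0..T})"
    using g t unfolding C1_on_def vector_derivative_works[symmetric]
    by (blast intro: differentiableI_vector)
  then show "(g has_derivative (\<lambda>h. h *\<^sub>R ?g' t)) (at t within {0..T})"
    by (simp add: has_vector_derivative_def)
  have "ennreal (norm (?g' t)) \<le> sup_norm {0..T} ?g'"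
    unfolding sup_norm_def by (rule SUP_upper[OF t])
  also have "\<dots> \<le> C1_norm T g"
    by (simp add: C1_norm_def)
  also note assms(2)
  finally have "norm (?g' t) \<le> \<delta>"
    using assms(3) by simp
  then show "onorm (\<lambda>h. h *\<^sub>R ?g' t) \<le> \<delta>"
    by (simp add: onorm_scaleR_left[OF bounded_linear_ident] onorm_id)
qed (use assms(3) in auto)

lemma C1_on_shift_minus_affine:
  assumes "C1_on {\<sigma>..\<sigma> + \<tau>} \<gamma>"
  shows "C1_on {0..\<tau>} (\<lambda>s. \<gamma> (\<sigma> + s) - (a + s *\<^sub>R v))"
proof -
  obtain f' where f': "continuous_on {\<sigma>..\<sigma> + \<tau>} f'"
    and d: "\<And>t. t \<in> {\<sigma>..\<sigma> + \<tau>} \<Longrightarrow> (\<gamma> has_vector_derivative f' t) (at t within {\<sigma>..\<sigma> + \<tau>})"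
    using assms unfolding C1_on_def by blast
  have img: "(+) \<sigma> ` {0..\<tau>} = {\<sigma>..\<sigma> + \<tau>}"
    by (simp add: add.commute)
  have "continuous_on {0..\<tau>} (\<lambda>s. f' (\<sigma> + s) - v)"
    by (intro continuous_intros continuous_on_compose2[OF f']) auto
  moreover have "((\<lambda>s. \<gamma> (\<sigma> + s) - (a + s *\<^sub>R v)) has_vector_derivative f' (\<sigma> + s) - v)
      (at s within {0..\<tau>})" if s: "s \<in> {0..\<tau>}" for s
  proof -
    have "((+) \<sigma> has_vector_derivative 1) (at s within {0..\<tau>})"
      by (auto intro!: derivative_eq_intros)
    from vector_diff_chain_within[OF this, of \<gamma> "f' (\<sigma> + s)"] d[of "\<sigma> + s"] s
    have "((\<lambda>s. \<gamma> (\<sigma> + s)) has_vector_derivative f' (\<sigma> + s)) (at s within {0..\<tau>})"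
      unfolding img by (simp add: o_def)
    then show ?thesis
      by (auto intro!: derivative_eq_intros)
  qed
  ultimately show ?thesis
    unfolding C1_on_def by blast
qed

text \<open>
  The remainder \<open>\<beta>\<close> is the shifted prolongation minus the affine one, cut off outside
  \<open>[-r, \<tau>]\<close>.  It is Lipschitz across \<open>0\<close> because it is zero to the left and its value at \<open>0\<close>
  is zero as well.  For \<open>\<tau> = 0\<close> the remainder is zero.
\<close>

lemma Lam1_decomposition:
  fixes \<psi> :: "real \<Rightarrow> 'a::real_normed_vector"
  assumes "0 \<le> r" and \<psi>: "\<psi> \<in> Maps {-r..0}" and "0 \<le> \<delta>"
    and "(t, \<phi>) \<in> Lam1 {-r..0} \<sigma> \<psi> T (ennreal \<delta>) v"
  obtains \<tau> \<beta> where "0 \<le> \<tau>" and "\<tau> \<le> T" and "t = \<sigma> + \<tau>"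
    and "\<beta> \<in> Gam {-r..0} 0 (\<lambda>_. 0) \<tau> (ennreal \<delta>)"
    and "\<delta>-lipschitz_on {-r..\<tau>} \<beta>"
    and "\<phi> = (\<lambda>\<theta>. hist_at {-r..0} \<tau> (wedge \<psi> v) \<theta> + hist_at {-r..0} \<tau> \<beta> \<theta>)"
proof -
  obtain \<tau> \<gamma> where \<tau>: "0 \<le> \<tau>" "\<tau> \<le> T" "t = \<sigma> + \<tau>"
    and \<phi>: "\<phi> = hist_at {-r..0} (\<sigma> + \<tau>) \<gamma>" and \<gamma>: "\<gamma> \<in> Gam1 {-r..0} \<sigma> \<psi> \<tau> (ennreal \<delta>) v"
    using assms(4) unfolding Lam1_def by auto
  define g where "g = (\<lambda>s. \<gamma> (\<sigma> + s) - (\<psi> 0 + s *\<^sub>R v))"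
  define \<beta> where "\<beta> = (\<lambda>s. if s \<in> {-r..\<tau>} then \<gamma> (\<sigma> + s) - wedge \<psi> v s else 0)"
  have hist: "\<gamma> (\<sigma> + \<theta>) = \<psi> \<theta>" if "\<theta> \<in> {-r..0}" for \<theta>
  proof (cases "\<tau> = 0")
    case False
    then have "hist_at {-r..0} \<sigma> \<gamma> = \<psi>"
      using \<gamma> by (simp add: Gam1_def C1_prolongation_def prolongation_def)
    then show ?thesis
      using that by (auto simp: hist_at_def fun_eq_iff split: if_splits)
  qed (use \<gamma> in \<open>simp add: Gam1_def\<close>)
  have \<beta>_left: "\<beta> s = 0" if "s \<le> 0" for s
    using that hist[of s] by (auto simp: \<beta>_def wedge_def)
  have \<beta>_right: "\<beta> s = g s" if "s \<in> {0..\<tau>}" for s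
    using that assms(1) by (auto simp: \<beta>_def wedge_def g_def)
  have g0: "g 0 = 0"
    using hist[of 0] assms(1) by (simp add: g_def)
  have g: "\<delta>-lipschitz_on {0..\<tau>} g \<and> sup_norm {0..\<tau>} g \<le> ennreal \<delta>"
  proof (cases "\<tau> = 0")
    case True
    then show ?thesis using g0 assms(3) by (simp add: sup_norm_def)
  next
    case False
    have vd: "vector_derivative (\<lambda>s. \<gamma> (\<sigma> + s) - wedge \<psi> v s) (at t within {0..\<tau>})
        = vector_derivative g (at t within {0..\<tau>})" if "t \<in> {0..\<tau>}" for t
      by (rule vector_derivative_cong_eq) (use that in \<open>auto simp: g_def wedge_def eventually_at_filter\<close>)
    have "C1_norm \<tau> (\<lambda>s. \<gamma> (\<sigma> + s) - wedge \<psi> v s) = C1_norm \<tau> g"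
      using vd by (simp add: C1_norm_def sup_norm_def g_def wedge_def cong: SUP_cong_simp)
    then have norm: "C1_norm \<tau> g \<le> ennreal \<delta>"
      using \<gamma> False by (simp add: Gam1_def)
    have "C1_on {0..\<tau>} g"
      using \<gamma> False unfolding g_def
      by (intro C1_on_shift_minus_affine) (simp add: Gam1_def C1_prolongation_def)
    moreover have "sup_norm {0..\<tau>} g \<le> C1_norm \<tau> g"
      by (simp add: C1_norm_def)
    ultimately show ?thesis
      using norm C1_norm_bounded_imp_lipschitz[of \<tau> g \<delta>] assms(3) by (meson order_trans)
  qed
  have "\<delta>-lipschitz_on {-r..0} (\<lambda>_. 0::'a)"
    by (rule lipschitz_on_le[OF lipschitz_on_constant assms(3)])
  from lipschitz_on_concat[OF this conjunct1[OF g]] g0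
  have "\<delta>-lipschitz_on {-r..\<tau>} (\<lambda>s. if s \<le> 0 then 0 else g s)"
    by simp
  then have lip: "\<delta>-lipschitz_on {-r..\<tau>} \<beta>"
    by (rule lipschitz_on_transform) (auto simp: \<beta>_left \<beta>_right)
  have "sup_norm {0..\<tau>} (\<lambda>s. \<beta> (0 + s) - 0) \<le> ennreal \<delta>"
    using conjunct2[OF g] by (simp add: sup_norm_def \<beta>_right cong: SUP_cong_simp)
  moreover have "prolongation {-r..0} 0 (\<lambda>_. 0) {0..0 + \<tau>} \<beta>"
    unfolding prolongation_def
  proof (intro conjI)
    have "x \<in> {0..\<tau>} + {-r..0}" if "x \<in> {-r..\<tau>}" for x
      using set_plus_intro[of x "{0..\<tau>}" 0 "{-r..0}"] set_plus_intro[of 0 "{0..\<tau>}" x "{-r..0}"]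
        that \<tau>(1) assms(1) by (cases "0 \<le> x") auto
    then show "\<beta> \<in> Maps ({0..0 + \<tau>} + {-r..0})"
      by (auto simp: Maps_def \<beta>_def)
    show "continuous_on {0..0 + \<tau>} \<beta>"
      by (rule continuous_on_subset[OF lipschitz_on_continuous_on[OF lip]]) (use assms(1) in auto)
    show "hist_at {-r..0} 0 \<beta> = (\<lambda>_. 0)"
      by (auto simp: hist_at_def \<beta>_left)
  qed (use \<tau>(1) in \<open>auto simp: is_interval_cc\<close>)
  ultimately have "\<beta> \<in> Gam {-r..0} 0 (\<lambda>_. 0) \<tau> (ennreal \<delta>)"
    by (simp add: Gam_def)
  moreover have "\<phi> = (\<lambda>\<theta>. hist_at {-r..0} \<tau> (wedge \<psi> v) \<theta> + hist_at {-r..0} \<tau> \<beta> \<theta>)"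
    using \<tau>(1) by (auto simp: \<phi> hist_at_def \<beta>_def fun_eq_iff add.assoc)
  ultimately show thesis
    using that \<tau> lip by blast
qed

lemma Lam1_lipschitz:
  assumes "0 \<le> r" and "\<psi> \<in> Maps {-r..0}" and C: "C-lipschitz_on {-r..0} \<psi>" and "0 \<le> \<delta>"
    and "(t, \<phi>) \<in> Lam1 {-r..0} \<sigma> \<psi> T (ennreal \<delta>) v"
  shows "(max C (norm v) + \<delta>)-lipschitz_on {-r..0} \<phi>"
proof -
  obtain \<tau> \<beta> where \<tau>: "0 \<le> \<tau>" and \<beta>: "\<delta>-lipschitz_on {-r..\<tau>} \<beta>"
    and \<phi>: "\<phi> = (\<lambda>\<theta>. hist_at {-r..0} \<tau> (wedge \<psi> v) \<theta> + hist_at {-r..0} \<tau> \<beta> \<theta>)"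
    using Lam1_decomposition[OF assms(1,2,4,5)] by metis
  have segment: "K-lipschitz_on {-r..0} (hist_at {-r..0} \<tau> f)"
    if f: "K-lipschitz_on {-r..\<tau>} f" for K and f :: "real \<Rightarrow> 'a"
  proof (rule lipschitz_onI)
    fix x y assume "x \<in> {-r..0}" "y \<in> {-r..0}"
    then show "dist (hist_at {-r..0} \<tau> f x) (hist_at {-r..0} \<tau> f y) \<le> K * dist x y"
      using lipschitz_onD[OF f, of "\<tau> + x" "\<tau> + y"] \<tau> by (auto simp: hist_at_def)
  qed (rule lipschitz_on_nonneg[OF f])
  show ?thesis
    unfolding \<phi> by (intro lipschitz_on_add segment wedge_lipschitz C \<beta>)
qed

section \<open>Smallness in the history space\<close>

text \<open>
  Continuity of addition at \<open>(\<psi>, 0)\<close> splits the given neighbourhood into one of \<open>\<psi>\<close>, which fixes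
  \<open>T\<close> through the segments of the affine prolongation, and one of \<open>0\<close>, which fixes \<open>\<delta>\<close> through
  the remainders.  A bound on \<open>\<delta>\<close> can be prescribed since \<open>Lam\<close> grows with \<open>\<delta>\<close>.
\<close>

lemma Lam1_subset_nbhd:
  fixes H :: "(real \<Rightarrow> 'a::real_normed_vector) set"
  assumes "0 \<le> r" and hs: "history_space {-r..0} H X" and pro: "prolongable {-r..0} H X"
    and reg: "regulated_by_prolongations {-r..0} X" and \<psi>: "\<psi> \<in> H"
    and W: "nbhd (prod_topology euclideanreal X) (\<sigma>, \<psi>) W" and "0 < \<delta>0"
  obtains T \<delta> where "0 < T" and "0 < \<delta>" and "\<delta> \<le> \<delta>0"
    and "Lam1 {-r..0} \<sigma> \<psi> T (ennreal \<delta>) v \<subseteq> W"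
proof -
  let ?I = "{-r..0}"
  let ?w = "wedge \<psi> v"
  have \<psi>M: "\<psi> \<in> Maps ?I" and H: "topspace X = H" and zero: "(\<lambda>_. 0) \<in> H"
    and add: "continuous_map (prod_topology X X) X (\<lambda>(f, g). \<lambda>\<theta>. f \<theta> + g \<theta>)"
    using hs \<psi> unfolding history_space_def by auto
  obtain A U where A: "open A" "\<sigma> \<in> A" and U: "openin X U" "\<psi> \<in> U" and AU: "A \<times> U \<subseteq> W"
    using W unfolding nbhd_def openin_prod_topology_alt by (metis open_openin subset_trans)
  let ?P = "{p \<in> topspace (prod_topology X X). (\<lambda>(f, g). \<lambda>\<theta>. f \<theta> + g \<theta>) p \<in> U}"
  have "openin (prod_topology X X) ?P"
    using openin_continuous_map_preimage[OF add U(1)] .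
  moreover have "(\<psi>, \<lambda>_. 0) \<in> ?P"
    using \<psi> zero U(2) H by simp
  ultimately obtain U1 N where U1: "openin X U1" "\<psi> \<in> U1" and N: "openin X N" "(\<lambda>_. 0) \<in> N"
    and U1N_P: "U1 \<times> N \<subseteq> ?P"
    unfolding openin_prod_topology_alt by meson
  have U1N: "(\<lambda>\<theta>. f \<theta> + g \<theta>) \<in> U" if "f \<in> U1" "g \<in> N" for f g
    using subsetD[OF U1N_P, of "(f, g)"] that by simp
  obtain d1 where d1: "d1 > 0" "\<And>t. dist t \<sigma> < d1 \<Longrightarrow> t \<in> A"
    using A unfolding open_dist by blast
  have "continuous_map (top_of_set {0..}) X (\<lambda>t. hist_at ?I t ?w)"
    using pro \<psi> wedge_prolongation[OF assms(1) \<psi>M] unfolding prolongable_def by blast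
  from openin_continuous_map_preimage[OF this U1(1)]
  have "openin (top_of_set {0..}) {t \<in> {0..}. hist_at ?I t ?w \<in> U1}"
    by simp
  moreover have "0 \<in> {t \<in> {0..}. hist_at ?I t ?w \<in> U1}"
    using U1(2) hist_at_wedge_0[OF \<psi>M] by simp
  ultimately obtain d2 where d2: "d2 > 0"
    "\<And>t. 0 \<le> t \<Longrightarrow> dist t 0 < d2 \<Longrightarrow> hist_at ?I t ?w \<in> U1"
    unfolding openin_euclidean_subtopology_iff by force
  define T where "T = min d1 d2 / 2"
  have T: "0 < T" "T < d1" "T < d2"
    using d1(1) d2(1) by (auto simp: T_def)
  have "nbhd X (\<lambda>_. 0) N"
    using N openin_subset unfolding nbhd_def by blast
  then obtain \<delta>1 :: real where \<delta>1: "0 < \<delta>1"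
    "Lam ?I 0 (\<lambda>_. 0) T (ennreal \<delta>1) \<subseteq> {0..T} \<times> N"
    using reg T(1) unfolding regulated_by_prolongations_def by blast
  define \<delta> where "\<delta> = min \<delta>0 \<delta>1"
  have \<delta>: "0 < \<delta>" "\<delta> \<le> \<delta>0" "\<delta> \<le> \<delta>1"
    using assms(7) \<delta>1(1) by (auto simp: \<delta>_def)
  have "(t, \<phi>) \<in> W" if mem: "(t, \<phi>) \<in> Lam1 ?I \<sigma> \<psi> T (ennreal \<delta>) v" for t \<phi>
  proof -
    obtain \<tau> \<beta> where \<tau>: "0 \<le> \<tau>" "\<tau> \<le> T" "t = \<sigma> + \<tau>"
      and \<beta>: "\<beta> \<in> Gam ?I 0 (\<lambda>_. 0) \<tau> (ennreal \<delta>)"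
      and \<phi>: "\<phi> = (\<lambda>\<theta>. hist_at ?I \<tau> ?w \<theta> + hist_at ?I \<tau> \<beta> \<theta>)"
      using Lam1_decomposition[OF assms(1) \<psi>M less_imp_le[OF \<delta>(1)] mem] by metis
    have "\<beta> \<in> Gam ?I 0 (\<lambda>_. 0) \<tau> (ennreal \<delta>1)"
      using \<beta> \<delta>(3) unfolding Gam_def by (auto intro: order_trans ennreal_leI)
    then have "(0 + \<tau>, hist_at ?I (0 + \<tau>) \<beta>) \<in> Lam ?I 0 (\<lambda>_. 0) T (ennreal \<delta>1)"
      unfolding Lam_def using \<tau> by auto
    then have "hist_at ?I \<tau> \<beta> \<in> N"
      using \<delta>1(2) by auto
    moreover have "hist_at ?I \<tau> ?w \<in> U1"
      using d2(2)[of \<tau>] \<tau> T by simp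
    ultimately have "\<phi> \<in> U"
      unfolding \<phi> by (intro U1N)
    moreover have "t \<in> A"
      using d1(2)[of t] \<tau> T by (simp add: dist_norm)
    ultimately show ?thesis
      using AU by blast
  qed
  then show thesis
    using that T(1) \<delta>(1,2) by (metis subrelI)
qed

section \<open>The Lipschitz condition about prolongations\<close>

theorem theorem4p7:
  fixes r :: real
    and H :: "(real \<Rightarrow> 'a::banach) set"
    and X :: "(real \<Rightarrow> 'a) topology"
    and F :: "real \<times> (real \<Rightarrow> 'a) \<rightharpoonup> 'a"
    and \<sigma>\<^sub>0 :: real and \<psi>\<^sub>0 :: "real \<Rightarrow> 'a"
  assumes "0 < r"
    and "history_space {-r..0} H X"
    and "prolongable {-r..0} H X"
    and "regulated_by_prolongations {-r..0} X"
    and "dom F \<subseteq> UNIV \<times> H"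
    and "(\<sigma>\<^sub>0, \<psi>\<^sub>0) \<in> dom (restrict_C01 {-r..0} F)"
    and "almost_locally_Lipschitzian {-r..0} X F \<sigma>\<^sub>0 \<psi>\<^sub>0"
  shows "locally_Lipschitzian_about_C1_prolongations {-r..0} (restrict_C01 {-r..0} F) \<sigma>\<^sub>0 \<psi>\<^sub>0"
proof -
  let ?I = "{-r..0}" and ?G = "restrict_C01 {-r..0} F"
  define v where "v = the (?G (\<sigma>\<^sub>0, \<psi>\<^sub>0))"
  have dom: "dom ?G = dom F \<inter> (UNIV \<times> C01_loc ?I)"
    by (simp add: restrict_C01_def)
  have eq: "?G p = F p" if "p \<in> dom ?G" for p
    using that by (auto simp: restrict_C01_def restrict_map_def split: if_splits)
  have \<psi>H: "\<psi>\<^sub>0 \<in> H" and \<psi>C: "\<psi>\<^sub>0 \<in> C01_loc ?I"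
    using assms(5,6) dom by auto
  then have \<psi>M: "\<psi>\<^sub>0 \<in> Maps ?I"
    by (simp add: C01_loc_def)
  obtain C where C: "C-lipschitz_on ?I \<psi>\<^sub>0"
    using C01_loc_compact_imp_lipschitz[OF _ \<psi>C] by auto
  \<comment> \<open>The summand \<open>1\<close> makes room for the remainder, whose constant will be some \<open>\<delta> \<le> 1\<close>.\<close>
  define M where "M = max C (norm v) + 1"
  have "0 < M"
    unfolding M_def by (smt (verit) norm_ge_zero)
  then obtain W L where W: "nbhd (prod_topology euclideanreal X) (\<sigma>\<^sub>0, \<psi>\<^sub>0) W" and L: "0 < L"
    and Lip: "\<And>t \<phi>1 \<phi>2. (t, \<phi>1) \<in> W \<inter> dom F \<Longrightarrow> (t, \<phi>2) \<in> W \<inter> dom F \<Longrightarrow>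
      compact (supp ?I (\<lambda>\<theta>. \<phi>1 \<theta> - \<phi>2 \<theta>)) \<Longrightarrow> lip ?I \<phi>1 \<le> ennreal M \<Longrightarrow>
      lip ?I \<phi>2 \<le> ennreal M \<Longrightarrow> Lip_cond ?I F L t \<phi>1 \<phi>2"
    using assms(7) unfolding almost_locally_Lipschitzian_def by meson
  obtain T \<delta> where T: "0 < T" and \<delta>: "0 < \<delta>" "\<delta> \<le> 1"
    and sub: "Lam1 ?I \<sigma>\<^sub>0 \<psi>\<^sub>0 T (ennreal \<delta>) v \<subseteq> W"
    using Lam1_subset_nbhd[OF less_imp_le[OF assms(1)] assms(2-4) \<psi>H W zero_less_one] by metis
  have lip: "lip ?I \<phi> \<le> ennreal M" if "(t, \<phi>) \<in> Lam1 ?I \<sigma>\<^sub>0 \<psi>\<^sub>0 T (ennreal \<delta>) v" for t \<phi>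
  proof -
    have "M-lipschitz_on ?I \<phi>"
      by (rule lipschitz_on_le[OF Lam1_lipschitz[OF less_imp_le[OF assms(1)] \<psi>M C _ that]])
        (use \<delta> in \<open>auto simp: M_def\<close>)
    then show ?thesis
      unfolding lip_def by (blast intro: Inf_lower)
  qed
  have "Lip_cond ?I ?G L t \<phi>1 \<phi>2"
    if mem1: "(t, \<phi>1) \<in> Lam1 ?I \<sigma>\<^sub>0 \<psi>\<^sub>0 T (ennreal \<delta>) v" and dom1: "(t, \<phi>1) \<in> dom ?G"
      and mem2: "(t, \<phi>2) \<in> Lam1 ?I \<sigma>\<^sub>0 \<psi>\<^sub>0 T (ennreal \<delta>) v" and dom2: "(t, \<phi>2) \<in> dom ?G"
      and supp: "compact (supp ?I (\<lambda>\<theta>. \<phi>1 \<theta> - \<phi>2 \<theta>))" for t \<phi>1 \<phi>2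
  proof -
    have "Lip_cond ?I F L t \<phi>1 \<phi>2"
      using mem1 mem2 dom1 dom2 sub dom by (intro Lip supp lip[of t]) auto
    then show ?thesis
      by (simp add: Lip_cond_def eq[OF dom1] eq[OF dom2])
  qed
  then show ?thesis
    unfolding locally_Lipschitzian_about_C1_prolongations_def Let_def v_def[symmetric]
    using T \<delta>(1) L by blast
qed

end
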